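(* Let $M$ be a finite, Dirichlet-process (DP) or normalized generalized gamma process (NGGP) mixture, with unrestricted collapsed posterior $$\pi_M(\ell,u\mid\mathbf X)\propto p_M(\ell,u)\prod_{A\in\ell}m(\mathbf X_A)$$ over partitions $\ell$ of $[n]$ (the argument $u>0$ being present only for the NGGP). Assume that this target is proper, that $0<m(\mathbf X_A)<\infty$ for every nonempty $A\subseteq[n]$, and that the move-type, pair-selection and allocation probabilities are normalized on their eligible sets. With the forward and reverse auxiliary proposal variables $\omega,\bar\omega$ and acceptance probability $\alpha_H$ described in the context, and with $u$ held fixed, the scaffold-guided split-merge Metropolis-Hastings kernel $P_H(\cdot,\cdot\mid u)$ on partitions is reversible with respect to $\pi_M(\ell\mid u,\mathbf X)$ (with $u$ omitted for finite and DP mixtures). Moreover, the composition of this kernel with allocation kernels and auxiliary-variable kernels that preserve the same joint target $\pi_M(\ell,u\mid\mathbf X)$ leaves that joint target invariant.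
   Context: **Target.** $\mathbf X=(\mathbf x_1,\dots,\mathbf x_n)\in(\mathbb R^d)^n$; $m(\mathbf X_A)=\int\prod_{i\in A}f(\mathbf x_i\mid\theta)\,H_0(d\theta)$ for a likelihood $f$ and base measure $H_0$. With $K=|\ell|$, $n_A=|A|$, the priors are, up to factors not depending on $\ell$ (nor, for the NGGP, on $u$): - finite ($L\ge1$ components, $\gamma>0$): $p(\ell)\propto\frac{L!}{(L-K)!}\prod_{A\in\ell}\Gamma(n_A+\gamma)/\Gamma(\gamma)$ for $1\le K\le L$, zero otherwise; - DP ($\alpha>0$): $p(\ell)\propto\alpha^K\prod_{A\in\ell}\Gamma(n_A)$; - NGGP ($a>0$, $0<\sigma<1$, $\tau\ge0$): $p(\ell,u)\propto u^{n-1}\exp[-\frac a\sigma\{(u+\tau)^\sigma-\tau^\sigma\}]\,a^K\prod_{A\in\ell}\frac{\Gamma(n_A-\sigma)}{\Gamma(1-\sigma)(u+\tau)^{n_A-\sigma}}$, $u>0$. The chain lives on partitions with positive target value. **Scaffold.** $H$ is a connected simple graph on $[n]$; $N_H(v)$ is the neighbour set, $d_H(v)=|N_H(v)|$; $D_H(i,j)$ is the shortest-path distance with edges weighted by Euclidean length; $D_H^\star=\max(\bar D_H,\epsilon_D)$ where $\bar D_H$ is the median of $D_H$ over distinct unordered pairs and $\epsilon_D>0$ is fixed. Fix $\epsilon>0$ and $\kappa\ge0$. **Move type.** From $\ell$, a split is available if some block has at least two elements and (finite mixture) $|\ell|<L$; a merge is available if $|\ell|\ge2$. The split and merge probabilities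 $p_{\mathrm S}(\ell),p_{\mathrm M}(\ell)$ are $1/2$ each if both are available, and $1$ for the sole available one; if neither is available the kernel is the identity. **Pair selection.** A pair $i<j$ is drawn with normalized probability $w_o(i,j\mid\ell)$: for a split, over pairs in the same block, with $w_{\mathrm S}\propto\epsilon+\max\{D_H(i,j)/D_H^\star,10^{-8}\}$; for a merge, over pairs in different blocks, with $w_{\mathrm M}\propto\epsilon+\exp\{-D_H(i,j)/D_H^\star\}$. **Split.** Start with $R_1=\{i\}$, $R_2=\{j\}$ and visit the other members $v_1,\dots,v_m$ of the common block in increasing order of $\min\{D_H(v,i),D_H(v,j)\}$, ties broken by index. Each visited $v$ is allocated to $R_r$, $r\in\{1,2\}$, with probability $$q_{H,\kappa}(v\to r\mid R_1,R_2,u)=\frac{q_{0,M}(v\to r\mid R_1,R_2,u)\,e^{\kappa s_H(v,r)}}{\sum_{h=1}^2q_{0,M}(v\to h\mid R_1,R_2,u)\,e^{\kappa s_H(v,h)}},\qquad s_H(v,r)=\frac{|N_H(v)\cap R_r|}{\max\{1,d_H(v)\}},$$ where $q_{0,M}(v\to r\mid R_1,R_2,u)\propto c_M(|R_r|;u)\,m(\mathbf X_{R_r\cup\{v\}})/m(\mathbf X_{R_r})$ (normalized over $r=1,2$) with $c_M(s;u)=s+\gamma$ (finite), $s$ (DP), $(s-\sigma)/(u+\tau)$ (NGGP). The proposed $\ell'$ replaces the block by the final $R_1,R_2$. **Merge.** $\ell'$ replaces the blocks of $i$ and $j$ by their union. **Auxiliary variables.** $\omega=(o,i,j,b_1,\dots,b_m)$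 records the move type $o\in\{\mathrm S,\mathrm M\}$, the pair, and (for splits) the sequential allocations $b_t\in\{1,2\}$. Its probability is $\widetilde q_H(\omega\mid\ell,u)=p_o(\ell)\,w_o(i,j\mid\ell)\prod_{t=1}^m q_{H,\kappa}(v_t\to b_t\mid R_{1,t-1},R_{2,t-1},u)$ for a split (where $R_{r,t-1}$ are the subclusters before visiting $v_t$), and $p_o(\ell)\,w_o(i,j\mid\ell)$ for a merge. The reverse $\bar\omega$ of a split is the merge of the two new blocks with the same pair $(i,j)$; the reverse of a merge is the split with the same pair whose allocations send each visited observation back to its original block. **Acceptance and kernel.** $$\alpha_H(\ell,\ell';\omega\mid u)=1\wedge\frac{\pi_M(\ell',u\mid\mathbf X)\,\widetilde q_H(\bar\omega\mid\ell',u)}{\pi_M(\ell,u\mid\mathbf X)\,\widetilde q_H(\omega\mid\ell,u)}$$ (zero if the reverse path has zero probability). For $\ell'\ne\ell$, $P_H(\ell,\ell'\mid u)=\sum_\omega\widetilde q_H(\omega\mid\ell,u)\,\alpha_H(\ell,\ell';\omega\mid u)$, summed over all $\omega$ taking $\ell$ to $\ell'$; the diagonal entry is one minus the off-diagonal row sum. *)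

theory Defs
  imports
    "HOL-Probability.Probability"
    "HOL-Library.Disjoint_Sets"
    "Graph_Theory.Graph_Theory"
begin

text \<open>
  The constructor arguments are, in this order, \<open>L\<close> and \<open>\<gamma>\<close>; \<open>\<alpha>\<close>; \<open>a\<close>, \<open>\<sigma>\<close> and \<open>\<tau>\<close>.
\<close>

datatype mixture = FiniteMix nat real | DPMix real | NGGPMix real real real

fun valid_mixture :: "mixture \<Rightarrow> bool" where
  "valid_mixture (FiniteMix L \<gamma>) \<longleftrightarrow> 1 \<le> L \<and> 0 < \<gamma>"
| "valid_mixture (DPMix \<alpha>) \<longleftrightarrow> 0 < \<alpha>"
| "valid_mixture (NGGPMix a \<sigma> \<tau>) \<longleftrightarrow> 0 < a \<and> 0 < \<sigma> \<and> \<sigma> < 1 \<and> 0 \<le> \<tau>"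

text \<open>
  Observations are indexed by \<open>{1..num S}\<close>. The scaffold is a symmetric, loop-free digraph
  without parallel arcs, which is how simple undirected graphs are represented in
  \<open>Graph_Theory\<close>. The field \<open>eps\<close> is the additive constant of the pair-selection scores,
  \<open>epsD\<close> the lower bound on the distance scale, \<open>kappa\<close> the strength of the scaffold guidance.
\<close>

record ('d, 'th, 'e) sm_params =
  num :: nat
  data :: "nat \<Rightarrow> real ^ 'd"
  lik :: "real ^ 'd \<Rightarrow> 'th \<Rightarrow> real"
  base_measure :: "'th measure"
  mixt :: mixture
  scaffold :: "(nat, 'e) pre_digraph"
  eps :: real
  epsD :: real
  kappa :: real

text \<open>
  The marginal likelihood is a Lebesgue integral with values in \<open>[0, \<infinity>]\<close>, so that its
  finiteness is a genuine condition.
\<close>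

definition marg_ennreal :: "('d::finite, 'th, 'e) sm_params \<Rightarrow> nat set \<Rightarrow> ennreal" where
  "marg_ennreal S A = (\<integral>\<^sup>+\<theta>. ennreal (\<Prod>i\<in>A. lik S (data S i) \<theta>) \<partial>base_measure S)"

definition marg :: "('d::finite, 'th, 'e) sm_params \<Rightarrow> nat set \<Rightarrow> real" where
  "marg S A = enn2real (marg_ennreal S A)"

definition partitions :: "('d::finite, 'th, 'e) sm_params \<Rightarrow> nat set set set" where
  "partitions S = {\<l>. partition_on {1..num S} \<l>}"

text \<open>
  Only the NGGP has an auxiliary variable. For the other two priors \<open>u\<close> ranges over the one-point
  space \<open>{0}\<close> and nothing below depends on its value.
\<close>

definition aux_space :: "('d::finite, 'th, 'e) sm_params \<Rightarrow> real measure" where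
  "aux_space S = (case mixt S of
      NGGPMix a \<sigma> \<tau> \<Rightarrow> restrict_space lborel {0<..}
    | _ \<Rightarrow> count_space {0})"

text \<open>
  Priors are given up to factors that depend neither on the partition nor on \<open>u\<close>; such factors
  cancel in \<open>posterior\<close>.
\<close>

fun prior_weight :: "nat \<Rightarrow> mixture \<Rightarrow> nat set set \<Rightarrow> real \<Rightarrow> real" where
  "prior_weight n (FiniteMix L \<gamma>) \<l> u =
    (if 1 \<le> card \<l> \<and> card \<l> \<le> L
     then fact L / fact (L - card \<l>) * (\<Prod>A\<in>\<l>. Gamma (real (card A) + \<gamma>) / Gamma \<gamma>)
     else 0)"
| "prior_weight n (DPMix \<alpha>) \<l> u = \<alpha> ^ card \<l> * (\<Prod>A\<in>\<l>. Gamma (real (card A)))"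
| "prior_weight n (NGGPMix a \<sigma> \<tau>) \<l> u =
    u ^ (n - 1) * exp (- (a / \<sigma>) * ((u + \<tau>) powr \<sigma> - \<tau> powr \<sigma>)) * a ^ card \<l> *
    (\<Prod>A\<in>\<l>. Gamma (real (card A) - \<sigma>) / (Gamma (1 - \<sigma>) * (u + \<tau>) powr (real (card A) - \<sigma>)))"

definition target_weight :: "('d::finite, 'th, 'e) sm_params \<Rightarrow> nat set set \<Rightarrow> real \<Rightarrow> real" where
  "target_weight S \<l> u = prior_weight (num S) (mixt S) \<l> u * (\<Prod>A\<in>\<l>. marg S A)"

definition norm_const :: "('d::finite, 'th, 'e) sm_params \<Rightarrow> ennreal" where
  "norm_const S = (\<Sum>\<l>\<in>partitions S. \<integral>\<^sup>+u. ennreal (target_weight S \<l> u) \<partial>aux_space S)"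

definition proper_target :: "('d::finite, 'th, 'e) sm_params \<Rightarrow> bool" where
  "proper_target S \<longleftrightarrow> 0 < norm_const S \<and> norm_const S < \<infinity>"

definition posterior :: "('d::finite, 'th, 'e) sm_params \<Rightarrow> nat set set \<Rightarrow> real \<Rightarrow> real" where
  "posterior S \<l> u = target_weight S \<l> u / enn2real (norm_const S)"

definition cond_posterior :: "('d::finite, 'th, 'e) sm_params \<Rightarrow> real \<Rightarrow> nat set set \<Rightarrow> real" where
  "cond_posterior S u \<l> = posterior S \<l> u / (\<Sum>\<l>'\<in>partitions S. posterior S \<l>' u)"

definition states :: "('d::finite, 'th, 'e) sm_params \<Rightarrow> nat set set set" where
  "states S = {\<l> \<in> partitions S. \<forall>u \<in> space (aux_space S). 0 < posterior S \<l> u}"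

definition joint_space :: "('d::finite, 'th, 'e) sm_params \<Rightarrow> (nat set set \<times> real) measure" where
  "joint_space S = count_space (states S) \<Otimes>\<^sub>M aux_space S"

definition joint_target :: "('d::finite, 'th, 'e) sm_params \<Rightarrow> (nat set set \<times> real) measure" where
  "joint_target S = density (joint_space S) (\<lambda>(\<l>, u). ennreal (posterior S \<l> u))"

definition scaf_dist :: "('d::finite, 'th, 'e) sm_params \<Rightarrow> nat \<Rightarrow> nat \<Rightarrow> real" where
  "scaf_dist S i j = real_of_ereal (wf_digraph.\<mu> (scaffold S)
     (\<lambda>e. dist (data S (tail (scaffold S) e)) (data S (head (scaffold S) e))) i j)"

text \<open>
  For an even number of entries the two summands are the two middle entries, for an odd number
  they coincide. The value at the empty list is arbitrary; it is used only if there is a single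
  observation, in which case no move is available.
\<close>

definition median :: "real list \<Rightarrow> real" where
  "median xs = (sort xs ! ((length xs - 1) div 2) + sort xs ! (length xs div 2)) / 2"

definition median_dist :: "('d::finite, 'th, 'e) sm_params \<Rightarrow> real" where
  "median_dist S = median [scaf_dist S i j. i \<leftarrow> [1..<Suc (num S)], j \<leftarrow> [Suc i..<Suc (num S)]]"

definition dist_scale :: "('d::finite, 'th, 'e) sm_params \<Rightarrow> real" where
  "dist_scale S = max (median_dist S) (epsD S)"

definition nbrs :: "('d::finite, 'th, 'e) sm_params \<Rightarrow> nat \<Rightarrow> nat set" where
  "nbrs S v = {w. v \<rightarrow>\<^bsub>scaffold S\<^esub> w}"

definition split_avail :: "('d::finite, 'th, 'e) sm_params \<Rightarrow> nat set set \<Rightarrow> bool" where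
  "split_avail S \<l> \<longleftrightarrow> (\<exists>A\<in>\<l>. 2 \<le> card A) \<and>
     (case mixt S of FiniteMix L \<gamma> \<Rightarrow> card \<l> < L | _ \<Rightarrow> True)"

definition merge_avail :: "nat set set \<Rightarrow> bool" where
  "merge_avail \<l> \<longleftrightarrow> 2 \<le> card \<l>"

definition p_split :: "('d::finite, 'th, 'e) sm_params \<Rightarrow> nat set set \<Rightarrow> real" where
  "p_split S \<l> = (if split_avail S \<l> then if merge_avail \<l> then 1/2 else 1 else 0)"

definition p_merge :: "('d::finite, 'th, 'e) sm_params \<Rightarrow> nat set set \<Rightarrow> real" where
  "p_merge S \<l> = (if merge_avail \<l> then if split_avail S \<l> then 1/2 else 1 else 0)"

definition split_pairs :: "nat set set \<Rightarrow> (nat \<times> nat) set" where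
  "split_pairs \<l> = {(i, j). i < j \<and> (\<exists>A\<in>\<l>. i \<in> A \<and> j \<in> A)}"

definition merge_pairs :: "nat set set \<Rightarrow> (nat \<times> nat) set" where
  "merge_pairs \<l> = {(i, j). i < j \<and> (\<exists>A\<in>\<l>. \<exists>B\<in>\<l>. A \<noteq> B \<and> i \<in> A \<and> j \<in> B)}"

definition split_score :: "('d::finite, 'th, 'e) sm_params \<Rightarrow> nat \<times> nat \<Rightarrow> real" where
  "split_score S = (\<lambda>(i, j). eps S + max (scaf_dist S i j / dist_scale S) (1 / 10 ^ 8))"

definition merge_score :: "('d::finite, 'th, 'e) sm_params \<Rightarrow> nat \<times> nat \<Rightarrow> real" where
  "merge_score S = (\<lambda>(i, j). eps S + exp (- (scaf_dist S i j / dist_scale S)))"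

definition w_split :: "('d::finite, 'th, 'e) sm_params \<Rightarrow> nat set set \<Rightarrow> nat \<times> nat \<Rightarrow> real" where
  "w_split S \<l> ij = (if ij \<in> split_pairs \<l>
     then split_score S ij / (\<Sum>kl\<in>split_pairs \<l>. split_score S kl) else 0)"

definition w_merge :: "('d::finite, 'th, 'e) sm_params \<Rightarrow> nat set set \<Rightarrow> nat \<times> nat \<Rightarrow> real" where
  "w_merge S \<l> ij = (if ij \<in> merge_pairs \<l>
     then merge_score S ij / (\<Sum>kl\<in>merge_pairs \<l>. merge_score S kl) else 0)"

definition block :: "nat set set \<Rightarrow> nat \<Rightarrow> nat set" where
  "block \<l> i = (THE A. A \<in> \<l> \<and> i \<in> A)"

text \<open>
  \<open>sort_key\<close> is stable and is applied to an increasing list, so ties are broken by index.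
\<close>

definition visit_order :: "('d::finite, 'th, 'e) sm_params \<Rightarrow> nat set \<Rightarrow> nat \<Rightarrow> nat \<Rightarrow> nat list" where
  "visit_order S A i j =
     sort_key (\<lambda>v. min (scaf_dist S v i) (scaf_dist S v j)) (sorted_list_of_set (A - {i, j}))"

text \<open>
  The two growing subclusters are \<open>R 1\<close> and \<open>R 2\<close> for a function \<open>R\<close> on labels.
\<close>

fun alloc_coeff :: "mixture \<Rightarrow> nat \<Rightarrow> real \<Rightarrow> real" where
  "alloc_coeff (FiniteMix L \<gamma>) s u = real s + \<gamma>"
| "alloc_coeff (DPMix \<alpha>) s u = real s"
| "alloc_coeff (NGGPMix a \<sigma> \<tau>) s u = (real s - \<sigma>) / (u + \<tau>)"

definition alloc_weight ::
    "('d::finite, 'th, 'e) sm_params \<Rightarrow> real \<Rightarrow> (nat \<Rightarrow> nat set) \<Rightarrow> nat \<Rightarrow> nat \<Rightarrow> real" where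
  "alloc_weight S u R v r =
     alloc_coeff (mixt S) (card (R r)) u * (marg S (insert v (R r)) / marg S (R r))"

definition q0 ::
    "('d::finite, 'th, 'e) sm_params \<Rightarrow> real \<Rightarrow> (nat \<Rightarrow> nat set) \<Rightarrow> nat \<Rightarrow> nat \<Rightarrow> real" where
  "q0 S u R v r = alloc_weight S u R v r / (\<Sum>h\<in>{1, 2}. alloc_weight S u R v h)"

definition scaf_affinity ::
    "('d::finite, 'th, 'e) sm_params \<Rightarrow> (nat \<Rightarrow> nat set) \<Rightarrow> nat \<Rightarrow> nat \<Rightarrow> real" where
  "scaf_affinity S R v r = real (card (nbrs S v \<inter> R r)) / real (max 1 (card (nbrs S v)))"

definition q_alloc ::
    "('d::finite, 'th, 'e) sm_params \<Rightarrow> real \<Rightarrow> (nat \<Rightarrow> nat set) \<Rightarrow> nat \<Rightarrow> nat \<Rightarrow> real" where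
  "q_alloc S u R v r = q0 S u R v r * exp (kappa S * scaf_affinity S R v r) /
     (\<Sum>h\<in>{1, 2}. q0 S u R v h * exp (kappa S * scaf_affinity S R v h))"

definition init_clusters :: "nat \<Rightarrow> nat \<Rightarrow> nat \<Rightarrow> nat set" where
  "init_clusters i j = (\<lambda>_. {})(1 := {i}, 2 := {j})"

fun alloc_result :: "(nat \<Rightarrow> nat set) \<Rightarrow> (nat \<times> nat) list \<Rightarrow> nat \<Rightarrow> nat set" where
  "alloc_result R [] = R"
| "alloc_result R ((v, b) # vbs) = alloc_result (R(b := insert v (R b))) vbs"

fun alloc_prob ::
    "('d::finite, 'th, 'e) sm_params \<Rightarrow> real \<Rightarrow> (nat \<Rightarrow> nat set) \<Rightarrow> (nat \<times> nat) list \<Rightarrow> real" where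
  "alloc_prob S u R [] = 1"
| "alloc_prob S u R ((v, b) # vbs) =
     q_alloc S u R v b * alloc_prob S u (R(b := insert v (R b))) vbs"

datatype proposal = Split nat nat "nat list" | Merge nat nat

definition proposals :: "('d::finite, 'th, 'e) sm_params \<Rightarrow> nat set set \<Rightarrow> proposal set" where
  "proposals S \<l> =
     {Split i j bs | i j bs. (i, j) \<in> split_pairs \<l> \<and>
        length bs = length (visit_order S (block \<l> i) i j) \<and> set bs \<subseteq> {1, 2}} \<union>
     {Merge i j | i j. (i, j) \<in> merge_pairs \<l>}"

fun propose :: "('d::finite, 'th, 'e) sm_params \<Rightarrow> nat set set \<Rightarrow> proposal \<Rightarrow> nat set set" where
  "propose S \<l> (Split i j bs) =
     (let R = alloc_result (init_clusters i j) (zip (visit_order S (block \<l> i) i j) bs)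
      in (\<l> - {block \<l> i}) \<union> {R 1, R 2})"
| "propose S \<l> (Merge i j) =
     (\<l> - {block \<l> i, block \<l> j}) \<union> {block \<l> i \<union> block \<l> j}"

definition proposal_prob ::
    "('d::finite, 'th, 'e) sm_params \<Rightarrow> real \<Rightarrow> nat set set \<Rightarrow> proposal \<Rightarrow> real" where
  "proposal_prob S u \<l> \<omega> = (if \<omega> \<in> proposals S \<l> then
     (case \<omega> of
        Split i j bs \<Rightarrow> p_split S \<l> * w_split S \<l> (i, j) *
          alloc_prob S u (init_clusters i j) (zip (visit_order S (block \<l> i) i j) bs)
      | Merge i j \<Rightarrow> p_merge S \<l> * w_merge S \<l> (i, j))
     else 0)"

fun reverse_proposal :: "('d::finite, 'th, 'e) sm_params \<Rightarrow> nat set set \<Rightarrow> proposal \<Rightarrow> proposal" where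
  "reverse_proposal S \<l> (Split i j bs) = Merge i j"
| "reverse_proposal S \<l> (Merge i j) =
     Split i j (map (\<lambda>v. if v \<in> block \<l> i then 1 else 2)
       (visit_order S (block \<l> i \<union> block \<l> j) i j))"

text \<open>
  A proposal whose reverse has probability zero is rejected, because the numerator then vanishes.
\<close>

definition accept ::
    "('d::finite, 'th, 'e) sm_params \<Rightarrow> real \<Rightarrow> nat set set \<Rightarrow> nat set set \<Rightarrow> proposal \<Rightarrow> real" where
  "accept S u \<l> \<l>' \<omega> = min 1
     (posterior S \<l>' u * proposal_prob S u \<l>' (reverse_proposal S \<l> \<omega>) /
      (posterior S \<l> u * proposal_prob S u \<l> \<omega>))"

definition off_diag ::
    "('d::finite, 'th, 'e) sm_params \<Rightarrow> real \<Rightarrow> nat set set \<Rightarrow> nat set set \<Rightarrow> real" where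
  "off_diag S u \<l> \<l>' =
     (\<Sum>\<omega> \<in> {\<omega> \<in> proposals S \<l>. propose S \<l> \<omega> = \<l>'}. proposal_prob S u \<l> \<omega> * accept S u \<l> \<l>' \<omega>)"

text \<open>
  If neither move is available, both move probabilities vanish and the kernel is the identity.
\<close>

definition P_kernel ::
    "('d::finite, 'th, 'e) sm_params \<Rightarrow> real \<Rightarrow> nat set set \<Rightarrow> nat set set \<Rightarrow> real" where
  "P_kernel S u \<l> \<l>' = (if \<l>' = \<l>
     then 1 - (\<Sum>\<l>''\<in>states S - {\<l>}. off_diag S u \<l> \<l>'')
     else off_diag S u \<l> \<l>')"

definition stochastic_on :: "'s set \<Rightarrow> ('s \<Rightarrow> 's \<Rightarrow> real) \<Rightarrow> bool" where
  "stochastic_on \<Omega> P \<longleftrightarrow> (\<forall>x\<in>\<Omega>. (\<forall>y\<in>\<Omega>. 0 \<le> P x y) \<and> (\<Sum>y\<in>\<Omega>. P x y) = 1)"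

definition reversible_on :: "'s set \<Rightarrow> ('s \<Rightarrow> real) \<Rightarrow> ('s \<Rightarrow> 's \<Rightarrow> real) \<Rightarrow> bool" where
  "reversible_on \<Omega> \<pi> P \<longleftrightarrow> (\<forall>x\<in>\<Omega>. \<forall>y\<in>\<Omega>. \<pi> x * P x y = \<pi> y * P y x)"

definition markov_kernel :: "'s measure \<Rightarrow> ('s \<Rightarrow> 's measure) \<Rightarrow> bool" where
  "markov_kernel M K \<longleftrightarrow> K \<in> M \<rightarrow>\<^sub>M prob_algebra M"

definition preserves :: "'s measure \<Rightarrow> ('s \<Rightarrow> 's measure) \<Rightarrow> bool" where
  "preserves T K \<longleftrightarrow> T \<bind> K = T"

text \<open>The kernels in the list are applied from left to right.\<close>

fun compose_kernels :: "'s measure \<Rightarrow> ('s \<Rightarrow> 's measure) list \<Rightarrow> 's \<Rightarrow> 's measure" where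
  "compose_kernels M [] = return M"
| "compose_kernels M (K # Ks) = (\<lambda>x. K x \<bind> compose_kernels M Ks)"

text \<open>The transition matrix \<open>P_kernel S u\<close> acting on the partition while \<open>u\<close> stays fixed.\<close>

definition split_merge ::
    "('d::finite, 'th, 'e) sm_params \<Rightarrow> nat set set \<times> real \<Rightarrow> (nat set set \<times> real) measure" where
  "split_merge S = (\<lambda>(\<l>, u).
     distr (point_measure (states S) (\<lambda>\<l>'. ennreal (P_kernel S u \<l> \<l>')))
       (joint_space S) (\<lambda>\<l>'. (\<l>', u)))"

end

theory Submission
  imports Defs
begin

text \<open>
  A split and the reversal of the merge undoing it visit the block in the same order, and the
  labels of a split with a given pair are determined by the two blocks it creates. Hence
  \<open>reverse_proposal\<close> maps the auxiliary variables leading from \<open>\<l>\<close> to \<open>\<l>'\<close> bijectively onto those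
  leading back, and it is its own inverse. Writing \<open>\<omega>\<^sup>-\<close> for the reverse of \<open>\<omega>\<close>, each \<open>\<omega>\<close>
  contributes the minimum of \<open>\<pi>(\<l>) q(\<omega> | \<l>)\<close> and \<open>\<pi>(\<l>') q(\<omega>\<^sup>- | \<l>')\<close> to the flux from \<open>\<l>\<close>
  to \<open>\<l>'\<close>, which is symmetric. Summing detailed balance over the partitions and integrating
  over \<open>u\<close> yields invariance of the joint target.
\<close>

subsection \<open>Partitions and reversal of proposals\<close>

lemma partition_on_disjoint:
  "partition_on X \<l> \<Longrightarrow> A \<in> \<l> \<Longrightarrow> B \<in> \<l> \<Longrightarrow> A \<noteq> B \<Longrightarrow> A \<inter> B = {}"
  using partition_onD2 disjointD by metis

lemma block_eq:
  assumes "partition_on X \<l>" "A \<in> \<l>" "i \<in> A"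
  shows "block \<l> i = A"
  unfolding block_def
proof (rule the_equality)
  show "B = A" if "B \<in> \<l> \<and> i \<in> B" for B
    using that assms partition_on_disjoint[OF assms(1), of A B] by blast
qed (use assms in auto)

lemma partition_on_split:
  assumes "partition_on X \<l>" "B \<union> C \<in> \<l>" "B \<inter> C = {}" "B \<noteq> {}" "C \<noteq> {}"
  shows "partition_on X (\<l> - {B \<union> C} \<union> {B, C})"
proof (rule partition_onI)
  show "\<Union> (\<l> - {B \<union> C} \<union> {B, C}) = X"
    using assms(2) partition_onD1[OF assms(1)] by blast
next
  fix p q assume pq: "p \<in> \<l> - {B \<union> C} \<union> {B, C}" "q \<in> \<l> - {B \<union> C} \<union> {B, C}" "p \<noteq> q"
  have disj: "D \<inter> B = {}" "D \<inter> C = {}" if "D \<in> \<l> - {B \<union> C}" for D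
    using that assms(2) partition_on_disjoint[OF assms(1), of D "B \<union> C"] by blast+
  from pq consider "p \<in> \<l>" "q \<in> \<l>" | "p \<in> \<l> - {B \<union> C}" "q = B \<or> q = C"
    | "q \<in> \<l> - {B \<union> C}" "p = B \<or> p = C" | "p = B" "q = C" | "p = C" "q = B" by blast
  then have "p \<inter> q = {}"
  proof cases
    case 1
    then show ?thesis using partition_on_disjoint[OF assms(1)] pq(3) by simp
  next
    case 2
    then show ?thesis using disj[of p] by blast
  next
    case 3
    then show ?thesis using disj[of q] by blast
  qed (use assms(3) in blast)+
  then show "disjnt p q" by (simp add: disjnt_def)
next
  show "{} \<notin> \<l> - {B \<union> C} \<union> {B, C}"
    using assms(4,5) partition_onD3[OF assms(1)] by blast
qed

lemma partition_on_merge: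
  assumes "partition_on X \<l>" "B \<in> \<l>" "C \<in> \<l>"
  shows "partition_on X (\<l> - {B, C} \<union> {B \<union> C})"
proof (rule partition_onI)
  show "\<Union> (\<l> - {B, C} \<union> {B \<union> C}) = X"
    using assms(2,3) partition_onD1[OF assms(1)] by blast
next
  fix p q assume pq: "p \<in> \<l> - {B, C} \<union> {B \<union> C}" "q \<in> \<l> - {B, C} \<union> {B \<union> C}" "p \<noteq> q"
  have disj: "D \<inter> (B \<union> C) = {}" if "D \<in> \<l> - {B, C}" for D
    using that assms partition_on_disjoint[OF assms(1), of D B]
      partition_on_disjoint[OF assms(1), of D C] by blast
  from pq consider "p \<in> \<l>" "q \<in> \<l>" | "p \<in> \<l> - {B, C}" "q = B \<union> C"
    | "q \<in> \<l> - {B, C}" "p = B \<union> C" by blast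
  then have "p \<inter> q = {}"
  proof cases
    case 1
    then show ?thesis using partition_on_disjoint[OF assms(1)] pq(3) by simp
  next
    case 2
    then show ?thesis using disj[of p] by simp
  next
    case 3
    then show ?thesis using disj[of q] by (simp add: Int_commute)
  qed
  then show "disjnt p q" by (simp add: disjnt_def)
next
  show "{} \<notin> \<l> - {B, C} \<union> {B \<union> C}"
    using assms(2) partition_onD3[OF assms(1)] by auto
qed

text \<open>Undoing a move deletes the blocks that the move created and restores the old ones. This
  gives back the original partition only if the created blocks were new, which is what the lemma is
  used for.\<close>

lemma partition_on_notin:
  assumes "partition_on X \<l>" "A \<in> \<l>" "B \<subseteq> A" "B \<noteq> {}" "B \<noteq> A"
  shows "B \<notin> \<l>"
proof
  assume "B \<in> \<l>"
  then have "B \<inter> A = {}"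
    using assms(1,2,5) by (intro partition_on_disjoint)
  with assms(3,4) show False by blast
qed

section \<open>Allocation paths and the blocks they create\<close>

lemma alloc_result_eq: "alloc_result R vbs r = R r \<union> {v. (v, r) \<in> set vbs}"
  by (induction vbs arbitrary: R) (auto split: if_splits)

lemma distinct_visit_order [simp]: "distinct (visit_order S A i j)"
  by (simp add: visit_order_def)

lemma set_visit_order: "finite A \<Longrightarrow> set (visit_order S A i j) = A - {i, j}"
  by (simp add: visit_order_def)

text \<open>A label other than \<open>1\<close> must be \<open>2\<close>, so the observations
  labelled \<open>1\<close> already determine the list. Hence the labels of a split can be recovered
  from the first of its two blocks.\<close>

lemma map_labels_zip:
  fixes bs :: "nat list"
  assumes "distinct vs" "length bs = length vs" "set bs \<subseteq> {1, 2}"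
  shows "map (\<lambda>v. if (v, 1) \<in> set (zip vs bs) then 1 else 2) vs = bs"
proof (rule nth_equalityI)
  fix k assume k: "k < length (map (\<lambda>v. if (v, 1) \<in> set (zip vs bs) then 1 else (2::nat)) vs)"
  have "(vs ! k, 1) \<in> set (zip vs bs) \<longleftrightarrow> bs ! k = 1"
    using k assms(1,2) by (auto simp: in_set_zip nth_eq_iff_index_eq simp del: One_nat_def)
  moreover have "bs ! k \<in> {1, 2}"
    by (rule subsetD[OF assms(3)]) (use k assms(2) in simp)
  ultimately show "map (\<lambda>v. if (v, 1) \<in> set (zip vs bs) then 1 else 2) vs ! k = bs ! k"
    using k by (simp del: One_nat_def) metis
qed (use assms(2) in simp)

lemma mem_zip_map_iff: "(v, b) \<in> set (zip vs (map f vs)) \<longleftrightarrow> v \<in> set vs \<and> b = f v"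
  by (induction vs) auto

text \<open>The visit order lists every member of the block other than \<open>i\<close> and
  \<open>j\<close> exactly once, so each receives exactly one label and the two final subclusters
  cut the block in two. The labels are expressed through \<open>B\<close> because this is the form
  in which \<open>reverse_proposal\<close> reverses a merge.\<close>

lemma split_structure:
  assumes part: "partition_on {1..num S} \<l>" and mem: "Split i j bs \<in> proposals S \<l>"
  obtains B C where "B \<union> C \<in> \<l>" "B \<inter> C = {}" "i \<in> B" "j \<in> C" "i < j"
    "block \<l> i = B \<union> C"
    "propose S \<l> (Split i j bs) = \<l> - {B \<union> C} \<union> {B, C}"
    "bs = map (\<lambda>v. if v \<in> B then 1 else 2) (visit_order S (B \<union> C) i j)"
proof -
  from mem obtain A where A: "A \<in> \<l>" "i \<in> A" "j \<in> A" "i < j"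
    by (auto simp: proposals_def split_pairs_def)
  have blk: "block \<l> i = A" using block_eq[OF part] A by auto
  have "A \<subseteq> {1..num S}" using A partition_onD1[OF part] by auto
  then have fin: "finite A" by (rule finite_subset) simp
  define vs where "vs = visit_order S A i j"
  have bs: "length bs = length vs" "set bs \<subseteq> {1, 2}"
    using mem by (auto simp: proposals_def blk vs_def)
  have vs: "distinct vs" "set vs = A - {i, j}"
    using fin by (simp_all add: vs_def set_visit_order)
  \<comment> \<open>\<open>B\<close> and \<open>C\<close> are the values of
    \<open>alloc_result\<close> at the labels \<open>1\<close> and \<open>2\<close>, in the closed
    form of \<open>alloc_result_eq\<close>.\<close>
  define B where "B = insert i {v. (v, 1) \<in> set (zip vs bs)}"
  define C where "C = insert j {v. (v, 2) \<in> set (zip vs bs)}"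
  have zip_vs: "(v, b) \<in> set (zip vs bs) \<Longrightarrow> v \<in> A - {i, j}" for v b
    using vs(2) by (auto dest: set_zip_leftD)
  have ex: "\<exists>b\<in>{1, 2}. (v, b) \<in> set (zip vs bs)" if "v \<in> A - {i, j}" for v
  proof -
    have "v \<in> set vs" using that vs(2) by simp
    then obtain k where "k < length vs" "vs ! k = v" unfolding in_set_conv_nth by blast
    moreover from this have "bs ! k \<in> {1, 2}"
      by (intro subsetD[OF bs(2)] nth_mem) (simp add: bs(1))
    ultimately have "(v, bs ! k) \<in> set (zip vs bs)" "bs ! k \<in> {1, 2}"
      using bs(1) by (auto simp: in_set_zip)
    then show ?thesis by blast
  qed
  have uniq: "b = b'" if "(v, b) \<in> set (zip vs bs)" "(v, b') \<in> set (zip vs bs)" for v b b'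
    using that vs(1) by (auto simp: in_set_zip nth_eq_iff_index_eq)
  have un: "B \<union> C = A"
  proof
    show "B \<union> C \<subseteq> A" using A zip_vs unfolding B_def C_def by blast
    show "A \<subseteq> B \<union> C" using ex unfolding B_def C_def by blast
  qed
  have dis: "B \<inter> C = {}"
  proof -
    have "False" if "(v, 1) \<in> set (zip vs bs)" "(v, 2) \<in> set (zip vs bs)" for v
      using uniq[OF that] by simp
    then show ?thesis using A(4) zip_vs unfolding B_def C_def by blast
  qed
  \<comment> \<open>The seed \<open>i\<close> is never visited, so on \<open>vs\<close> membership
    in \<open>B\<close> means carrying the label \<open>1\<close>.\<close>
  have "map (\<lambda>v. if v \<in> B then 1 else (2 :: nat)) vs = map (\<lambda>v. if (v, 1) \<in> set (zip vs bs) then 1 else 2) vs"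
    using vs(2) by (auto simp: B_def)
  then have "bs = map (\<lambda>v. if v \<in> B then 1 else 2) vs"
    using map_labels_zip[OF vs(1) bs] by (rule sym[OF trans])
  moreover have "propose S \<l> (Split i j bs) = \<l> - {A} \<union> {B, C}"
    by (simp add: blk alloc_result_eq init_clusters_def B_def C_def flip: vs_def)
  moreover have "i \<in> B" "j \<in> C" by (simp_all add: B_def C_def)
  ultimately show ?thesis
    using that[of B C] A un dis blk by (simp add: vs_def)
qed

lemma merge_structure:
  assumes "partition_on X \<l>" "Merge i j \<in> proposals S \<l>"
  obtains B C where "B \<in> \<l>" "C \<in> \<l>" "B \<inter> C = {}" "i \<in> B" "j \<in> C" "i < j"
    "block \<l> i = B" "block \<l> j = C"
    "propose S \<l> (Merge i j) = \<l> - {B, C} \<union> {B \<union> C}"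
proof -
  from assms(2) obtain B C where BC: "B \<in> \<l>" "C \<in> \<l>" "B \<noteq> C" "i \<in> B" "j \<in> C" "i < j"
    by (auto simp: proposals_def merge_pairs_def)
  moreover have "B \<inter> C = {}"
    using BC by (intro partition_on_disjoint[OF assms(1)])
  moreover have "block \<l> i = B" "block \<l> j = C"
    using block_eq[OF assms(1)] BC by auto
  ultimately show ?thesis using that[of B C] by auto
qed

text \<open>In the proposed partition the blocks of \<open>i\<close> and \<open>j\<close> are the
  two halves, so merging them restores the old block. The labels come back because the visit order
  depends only on the union of the halves and on the pair, which are the same in both
  directions.\<close>

lemma reverse_split:
  assumes part: "partition_on {1..num S} \<l>" and mem: "Split i j bs \<in> proposals S \<l>"
  defines "\<l>' \<equiv> propose S \<l> (Split i j bs)"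
  shows "partition_on {1..num S} \<l>'"
    and "Merge i j \<in> proposals S \<l>'"
    and "propose S \<l>' (Merge i j) = \<l>"
    and "reverse_proposal S \<l>' (Merge i j) = Split i j bs"
proof -
  from split_structure[OF part mem] obtain B C where BC:
    "B \<union> C \<in> \<l>" "B \<inter> C = {}" "i \<in> B" "j \<in> C" "i < j" "block \<l> i = B \<union> C"
    and l': "\<l>' = \<l> - {B \<union> C} \<union> {B, C}"
    and bs: "bs = map (\<lambda>v. if v \<in> B then 1 else 2) (visit_order S (B \<union> C) i j)"
    unfolding \<l>'_def .
  show part': "partition_on {1..num S} \<l>'"
    unfolding l' by (rule partition_on_split[OF part]) (use BC in auto)
  have blk: "block \<l>' i = B" "block \<l>' j = C"
    using block_eq[OF part'] BC l' by auto
  show "Merge i j \<in> proposals S \<l>'"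
    using BC unfolding l' by (auto simp: proposals_def merge_pairs_def)
  have "B \<notin> \<l>" "C \<notin> \<l>"
    by (rule partition_on_notin[OF part BC(1)]; use BC in blast)+
  then show "propose S \<l>' (Merge i j) = \<l>"
    using BC(1) by (auto simp: blk) (auto simp: l')
  show "reverse_proposal S \<l>' (Merge i j) = Split i j bs"
    by (simp add: blk bs)
qed

text \<open>The labels record which visited observations come from the block of \<open>i\<close>, so
  replaying them along the visit order rebuilds the two original blocks.\<close>

lemma reverse_merge:
  assumes part: "partition_on {1..num S} \<l>" and mem: "Merge i j \<in> proposals S \<l>"
  defines "\<l>' \<equiv> propose S \<l> (Merge i j)"
  shows "partition_on {1..num S} \<l>'"
    and "reverse_proposal S \<l> (Merge i j) \<in> proposals S \<l>'"
    and "propose S \<l>' (reverse_proposal S \<l> (Merge i j)) = \<l>"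
    and "reverse_proposal S \<l>' (reverse_proposal S \<l> (Merge i j)) = Merge i j"
proof -
  from merge_structure[OF part mem] obtain B C where BC:
    "B \<in> \<l>" "C \<in> \<l>" "B \<inter> C = {}" "i \<in> B" "j \<in> C" "i < j" "block \<l> i = B" "block \<l> j = C"
    and l': "\<l>' = \<l> - {B, C} \<union> {B \<union> C}"
    unfolding \<l>'_def .
  show part': "partition_on {1..num S} \<l>'"
    unfolding l' by (rule partition_on_merge[OF part]) (use BC in auto)
  have blk: "block \<l>' i = B \<union> C"
    using block_eq[OF part'] BC l' by auto
  define bs :: "nat list"
    where "bs = map (\<lambda>v. if v \<in> B then 1 else 2) (visit_order S (B \<union> C) i j)"
  have rev: "reverse_proposal S \<l> (Merge i j) = Split i j bs"
    by (simp add: BC bs_def)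
  have "(i, j) \<in> split_pairs \<l>'" using BC unfolding l' by (auto simp: split_pairs_def)
  then show "reverse_proposal S \<l> (Merge i j) \<in> proposals S \<l>'"
    unfolding rev by (auto simp: proposals_def blk bs_def)
  have "B \<union> C \<subseteq> {1..num S}" using BC partition_onD1[OF part] by auto
  then have "finite (B \<union> C)" by (rule finite_subset) simp
  then have vs: "set (visit_order S (B \<union> C) i j) = B \<union> C - {i, j}"
    by (rule set_visit_order)
  have R: "alloc_result (init_clusters i j) (zip (visit_order S (B \<union> C) i j) bs) 1 = B"
    "alloc_result (init_clusters i j) (zip (visit_order S (B \<union> C) i j) bs) 2 = C"
    using BC(3-5) unfolding alloc_result_eq bs_def mem_zip_map_iff vs
    by (auto simp: init_clusters_def)
  \<comment> \<open>If the union were already a block, its proper subset \<open>B\<close> could not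
    be one as well.\<close>
  have "B \<union> C \<notin> \<l>"
  proof
    assume "B \<union> C \<in> \<l>"
    then have "B \<notin> \<l>" by (rule partition_on_notin[OF part]) (use BC in blast)+
    with BC show False by blast
  qed
  then have "\<l>' - {B \<union> C} \<union> {B, C} = \<l>"
    using BC(1,2) by (auto simp: l')
  then show "propose S \<l>' (reverse_proposal S \<l> (Merge i j)) = \<l>"
    unfolding rev by (simp add: blk R Let_def del: One_nat_def)
  show "reverse_proposal S \<l>' (reverse_proposal S \<l> (Merge i j)) = Merge i j"
    by (simp add: rev)
qed

text \<open>Both move types together: this is the bijection by which the sums over auxiliary
  variables are reindexed in the detailed balance equation.\<close>

lemma reverse_proposal:
  assumes "\<l> \<in> partitions S" "\<omega> \<in> proposals S \<l>" "propose S \<l> \<omega> = \<l>'"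
  shows "reverse_proposal S \<l> \<omega> \<in> proposals S \<l>'"
    and "propose S \<l>' (reverse_proposal S \<l> \<omega>) = \<l>"
    and "reverse_proposal S \<l>' (reverse_proposal S \<l> \<omega>) = \<omega>"
proof -
  have "partition_on {1..num S} \<l>" using assms(1) by (simp add: partitions_def)
  then have "reverse_proposal S \<l> \<omega> \<in> proposals S \<l>' \<and>
    propose S \<l>' (reverse_proposal S \<l> \<omega>) = \<l> \<and>
    reverse_proposal S \<l>' (reverse_proposal S \<l> \<omega>) = \<omega>"
    using reverse_split[of S \<l>] reverse_merge[of S \<l>] assms(2,3)
    by (cases \<omega>) (metis reverse_proposal.simps(1))+
  then show "reverse_proposal S \<l> \<omega> \<in> proposals S \<l>'"
    "propose S \<l>' (reverse_proposal S \<l> \<omega>) = \<l>"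
    "reverse_proposal S \<l>' (reverse_proposal S \<l> \<omega>) = \<omega>"
    by auto
qed

subsection \<open>The transition matrix on partitions\<close>

text \<open>Here \<open>x\<close> stands for the target times the forward probability and
  \<open>y\<close> for the target times the reverse probability. At \<open>x = 0\<close> the
  convention \<open>y / 0 = 0\<close> does no harm: the left side vanishes with \<open>x\<close>,
  the right side because \<open>0 \<le> y\<close>.\<close>

lemma mult_min_ratio:
  fixes x y :: real
  assumes "0 \<le> x" "0 \<le> y"
  shows "x * min 1 (y / x) = min x y"
  using assms by (cases "x = 0") (auto simp: min_def field_simps)

text \<open>Gathers the sources of positivity: the mixture parameters and the marginals for the
  allocation weights, \<open>eps S\<close> for the pair scores.\<close>

locale split_merge_setting =
  fixes S :: "('d::finite, 'th, 'e) sm_params"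
  assumes valid: "valid_mixture (mixt S)"
    and eps_pos: "0 < eps S"
    and marg_ennreal_bounds:
      "A \<noteq> {} \<Longrightarrow> A \<subseteq> {1..num S} \<Longrightarrow> 0 < marg_ennreal S A \<and> marg_ennreal S A < \<infinity>"
begin

lemma finite_partitions: "finite (partitions S)"
  unfolding partitions_def by (rule finitely_many_partition_on) simp

lemma states_subset: "states S \<subseteq> partitions S"
  by (auto simp: states_def)

lemma finite_states: "finite (states S)"
  using states_subset finite_partitions by (rule finite_subset)

lemma posterior_pos: "\<l> \<in> states S \<Longrightarrow> u \<in> space (aux_space S) \<Longrightarrow> 0 < posterior S \<l> u"
  by (auto simp: states_def)

text \<open>Finiteness of the integral matters as much as its positivity, because
  \<open>enn2real\<close> sends infinity to \<open>0\<close>.\<close>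

lemma marg_pos: "A \<noteq> {} \<Longrightarrow> A \<subseteq> {1..num S} \<Longrightarrow> 0 < marg S A"
  unfolding marg_def using marg_ennreal_bounds[of A] by (simp add: enn2real_positive_iff)

text \<open>The bound \<open>1 \<le> s\<close> makes the DP coefficient \<open>s\<close> positive
  and, with \<sigma> below one, also the numerator \<open>s - \<sigma>\<close> of the NGGP. The NGGP
  denominator is positive because its auxiliary space contains only positive
  \<open>u\<close>.\<close>

lemma alloc_coeff_pos:
  assumes "u \<in> space (aux_space S)" "1 \<le> s"
  shows "0 < alloc_coeff (mixt S) s u"
  using assms valid by (cases "mixt S") (auto simp: aux_space_def space_restrict_space intro!: divide_pos_pos)

text \<open>Invariant of the sequential allocation. Only the labels \<open>1\<close> and
  \<open>2\<close> are constrained, since \<open>init_clusters\<close> is empty at every other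
  label.\<close>

definition clusters_ok :: "(nat \<Rightarrow> nat set) \<Rightarrow> bool" where
  "clusters_ok R \<longleftrightarrow> (\<forall>r\<in>{1, 2}. R r \<noteq> {} \<and> R r \<subseteq> {1..num S})"

lemma clusters_ok_insert:
  "clusters_ok R \<Longrightarrow> v \<in> {1..num S} \<Longrightarrow> clusters_ok (R(b := insert v (R b)))"
  by (auto simp: clusters_ok_def)

section \<open>Sequential allocation as a probability distribution on label lists\<close>

context
  fixes u :: real
  assumes u: "u \<in> space (aux_space S)"
begin

lemma alloc_weight_pos:
  assumes "clusters_ok R" "v \<in> {1..num S}" "r \<in> {1, 2}"
  shows "0 < alloc_weight S u R v r"
proof -
  have R: "R r \<noteq> {}" "R r \<subseteq> {1..num S}" using assms unfolding clusters_ok_def by blast+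
  then have "1 \<le> card (R r)"
    using finite_subset[OF R(2)] by (simp add: Suc_le_eq card_gt_0_iff)
  with R assms show ?thesis
    unfolding alloc_weight_def by (intro mult_pos_pos divide_pos_pos alloc_coeff_pos u marg_pos) auto
qed

text \<open>The allocation weights are positive and the exponential tilt keeps them so; hence both
  normalizing sums are positive and the normalization of the allocation step is a
  consequence.\<close>

lemma q_alloc_distribution:
  assumes "clusters_ok R" "v \<in> {1..num S}"
  shows "\<And>r. r \<in> {1, 2} \<Longrightarrow> 0 \<le> q_alloc S u R v r" "(\<Sum>r\<in>{1, 2}. q_alloc S u R v r) = 1"
proof -
  let ?e = "\<lambda>r. q0 S u R v r * exp (kappa S * scaf_affinity S R v r)"
  have "0 < q0 S u R v r" if "r \<in> {1, 2}" for r
    unfolding q0_def using that alloc_weight_pos[OF assms]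
    by (intro divide_pos_pos sum_pos) auto
  then have pos: "0 < ?e r" if "r \<in> {1, 2}" for r using that by simp
  then have sum_gt: "0 < (\<Sum>h\<in>{1, 2}. ?e h)" by (intro sum_pos) auto
  show "0 \<le> q_alloc S u R v r" if "r \<in> {1, 2}" for r
    unfolding q_alloc_def using pos[OF that] sum_gt by (intro divide_nonneg_pos) auto
  show "(\<Sum>r\<in>{1, 2}. q_alloc S u R v r) = 1"
    unfolding q_alloc_def sum_divide_distrib[symmetric] using sum_gt by simp
qed

lemma alloc_prob_nonneg:
  assumes "clusters_ok R" "set vs \<subseteq> {1..num S}" "set bs \<subseteq> {1, 2}"
  shows "0 \<le> alloc_prob S u R (zip vs bs)"
  using assms
proof (induction vs bs arbitrary: R rule: list_induct2')
  case (4 v vs b bs)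
  have "0 \<le> alloc_prob S u (R(b := insert v (R b))) (zip vs bs)"
    by (rule "4.IH"[OF clusters_ok_insert]) (use "4.prems" in auto)
  moreover have "0 \<le> q_alloc S u R v b"
    using "4.prems" by (intro q_alloc_distribution) auto
  ultimately show ?case by simp
qed simp_all

text \<open>Condition on the label of the first visited observation: the remaining labels have total
  probability one starting from the updated subclusters, which again satisfy the invariant, so only
  the one-step sum is left.\<close>

lemma sum_alloc_prob:
  assumes "clusters_ok R" "set vs \<subseteq> {1..num S}"
  shows "(\<Sum>bs | length bs = length vs \<and> set bs \<subseteq> {1, 2}. alloc_prob S u R (zip vs bs)) = 1"
  using assms
proof (induction vs arbitrary: R)
  case Nil
  have "{bs::nat list. length bs = length ([]::nat list) \<and> set bs \<subseteq> {1, 2}} = {[]}" by auto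
  then show ?case by simp
next
  case (Cons v vs)
  let ?L = "\<lambda>n. {bs::nat list. length bs = n \<and> set bs \<subseteq> {1, 2}}"
  have "(\<Sum>bs\<in>?L (length (v # vs)). alloc_prob S u R (zip (v # vs) bs)) =
    (\<Sum>(b, bs)\<in>{1, 2} \<times> ?L (length vs). alloc_prob S u R (zip (v # vs) (b # bs)))"
  proof (rule sum.reindex_bij_witness[where j = "\<lambda>bs. (hd bs, tl bs)" and i = "\<lambda>(b, bs). b # bs"])
    fix bs assume "bs \<in> ?L (length (v # vs))"
    then show "(case (hd bs, tl bs) of (b, bs) \<Rightarrow> b # bs) = bs"
      "(hd bs, tl bs) \<in> {1, 2} \<times> ?L (length vs)"
      "(case (hd bs, tl bs) of (b, bs) \<Rightarrow> alloc_prob S u R (zip (v # vs) (b # bs))) =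
        alloc_prob S u R (zip (v # vs) bs)"
      by (cases bs; force)+
  qed auto
  also have "\<dots> = (\<Sum>b\<in>{1, 2}. \<Sum>bs\<in>?L (length vs).
      q_alloc S u R v b * alloc_prob S u (R(b := insert v (R b))) (zip vs bs))"
    by (subst sum.cartesian_product) simp
  also have "\<dots> = (\<Sum>b\<in>{1, 2}. q_alloc S u R v b)"
  proof (rule sum.cong)
    fix b :: nat assume "b \<in> {1, 2}"
    have "(\<Sum>bs\<in>?L (length vs). alloc_prob S u (R(b := insert v (R b))) (zip vs bs)) = 1"
      by (rule Cons.IH[OF clusters_ok_insert]) (use Cons.prems in auto)
    then show "(\<Sum>bs\<in>?L (length vs). q_alloc S u R v b *
        alloc_prob S u (R(b := insert v (R b))) (zip vs bs)) = q_alloc S u R v b"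
      by (simp only: sum_distrib_left[symmetric] mult_1_right)
  qed simp
  also have "\<dots> = 1" using Cons.prems by (intro q_alloc_distribution) auto
  finally show ?case .
qed

end

section \<open>Pair selection and total proposal mass\<close>

lemma finite_pairs:
  assumes "\<l> \<in> partitions S"
  shows "finite (split_pairs \<l>)" "finite (merge_pairs \<l>)"
proof -
  have "\<Union>\<l> = {1..num S}" using assms by (auto simp: partitions_def dest: partition_onD1)
  then have "split_pairs \<l> \<subseteq> {1..num S} \<times> {1..num S}" "merge_pairs \<l> \<subseteq> {1..num S} \<times> {1..num S}"
    unfolding split_pairs_def merge_pairs_def by blast+
  then show "finite (split_pairs \<l>)" "finite (merge_pairs \<l>)"
    by (auto intro: finite_subset)
qed

text \<open>The floor \<open>1 / 10 ^ 8\<close> makes the maximum positive whatever the value of the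
  quotient.\<close>

lemma split_score_pos: "0 < split_score S ij"
proof (cases ij)
  case (Pair i j)
  have "0 < max (scaf_dist S i j / dist_scale S) (1 / 10 ^ 8)" by (rule less_max_iff_disj[THEN iffD2]) simp
  then show ?thesis using eps_pos by (simp add: split_score_def Pair)
qed

lemma merge_score_pos: "0 < merge_score S ij"
  using eps_pos by (cases ij) (simp add: merge_score_def add_pos_pos)

lemma w_nonneg: "0 \<le> w_split S \<l> ij" "0 \<le> w_merge S \<l> ij"
  by (auto simp: w_split_def w_merge_def intro!: divide_nonneg_nonneg sum_nonneg
      less_imp_le[OF split_score_pos] less_imp_le[OF merge_score_pos])

text \<open>The total is \<open>1\<close> unless the normalizing sum is \<open>0\<close>, as for an
  empty set of pairs; then division by zero makes it \<open>0\<close>. The inequality covers both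
  cases.\<close>

lemma sum_w_le_1:
  "(\<Sum>ij\<in>split_pairs \<l>. w_split S \<l> ij) \<le> 1" "(\<Sum>ij\<in>merge_pairs \<l>. w_merge S \<l> ij) \<le> 1"
  by (simp_all add: w_split_def w_merge_def divide_le_eq_1 flip: sum_divide_distrib)

lemma p_nonneg: "0 \<le> p_split S \<l>" "0 \<le> p_merge S \<l>"
  and p_sum_le_1: "p_split S \<l> + p_merge S \<l> \<le> 1"
  by (auto simp: p_split_def p_merge_def)

abbreviation allocs :: "nat set set \<Rightarrow> nat \<Rightarrow> nat \<Rightarrow> nat list set" where
  "allocs \<l> i j \<equiv>
     {bs. length bs = length (visit_order S (block \<l> i) i j) \<and> set bs \<subseteq> {1, 2}}"

text \<open>Injective images of a dependent sum and of a set of pairs: in this form finiteness is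
  immediate and sums over proposals become iterated sums over pairs and labels.\<close>

lemma proposals_eq:
  "proposals S \<l> = (\<lambda>((i, j), bs). Split i j bs) ` (SIGMA (i, j):split_pairs \<l>. allocs \<l> i j) \<union>
     (\<lambda>(i, j). Merge i j) ` merge_pairs \<l>"
proof (intro set_eqI iffI)
  fix \<omega> assume "\<omega> \<in> proposals S \<l>"
  then consider i j bs where "\<omega> = Split i j bs" "(i, j) \<in> split_pairs \<l>" "bs \<in> allocs \<l> i j"
    | i j where "\<omega> = Merge i j" "(i, j) \<in> merge_pairs \<l>"
    unfolding proposals_def by blast
  then show "\<omega> \<in> (\<lambda>((i, j), bs). Split i j bs) ` (SIGMA (i, j):split_pairs \<l>. allocs \<l> i j) \<union>
     (\<lambda>(i, j). Merge i j) ` merge_pairs \<l>"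
  proof cases
    case 1
    then show ?thesis by (intro UnI1 image_eqI[of _ _ "((i, j), bs)"]) auto
  next
    case 2
    then show ?thesis by (intro UnI2 image_eqI[of _ _ "(i, j)"]) auto
  qed
qed (auto simp: proposals_def)

lemma finite_proposals: "\<l> \<in> partitions S \<Longrightarrow> finite (proposals S \<l>)"
  unfolding proposals_eq using finite_lists_length_eq[of "{1, 2::nat}"]
  by (auto intro!: finite_imageI finite_SigmaI finite_pairs simp: conj_commute)

lemma init_clusters_ok:
  assumes "\<l> \<in> partitions S" "(i, j) \<in> split_pairs \<l>"
  shows "clusters_ok (init_clusters i j)" "set (visit_order S (block \<l> i) i j) \<subseteq> {1..num S}"
proof -
  have part: "partition_on {1..num S} \<l>" using assms(1) by (simp add: partitions_def)
  from assms(2) obtain A where A: "A \<in> \<l>" "i \<in> A" "j \<in> A" by (auto simp: split_pairs_def)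
  then have sub: "A \<subseteq> {1..num S}" using partition_onD1[OF part] by auto
  then have "finite A" by (rule finite_subset) simp
  with sub A block_eq[OF part A(1,2)]
  show "clusters_ok (init_clusters i j)" "set (visit_order S (block \<l> i) i j) \<subseteq> {1..num S}"
    by (auto simp: clusters_ok_def init_clusters_def set_visit_order)
qed

lemma proposal_prob_nonneg:
  assumes "u \<in> space (aux_space S)" "\<l> \<in> partitions S"
  shows "0 \<le> proposal_prob S u \<l> \<omega>"
proof (cases "\<omega> \<in> proposals S \<l>")
  case True
  show ?thesis
  proof (cases \<omega>)
    case (Split i j bs)
    with True have "(i, j) \<in> split_pairs \<l>" "set bs \<subseteq> {1, 2}" by (auto simp: proposals_def)
    then have "0 \<le> alloc_prob S u (init_clusters i j) (zip (visit_order S (block \<l> i) i j) bs)"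
      using init_clusters_ok[OF assms(2)] by (intro alloc_prob_nonneg assms(1)) auto
    then show ?thesis using Split by (simp add: proposal_prob_def p_nonneg w_nonneg)
  qed (simp add: proposal_prob_def p_nonneg w_nonneg)
qed (simp add: proposal_prob_def)

text \<open>Sum over the labels first, then over the pairs, then over the two move types. The mass
  is \<open>0\<close> when no move is available, hence an inequality; it is what keeps the diagonal
  of the kernel nonnegative.\<close>

lemma sum_proposal_prob_le_1:
  assumes u: "u \<in> space (aux_space S)" and \<l>: "\<l> \<in> partitions S"
  shows "(\<Sum>\<omega>\<in>proposals S \<l>. proposal_prob S u \<l> \<omega>) \<le> 1"
proof -
  let ?sp = "\<lambda>((i, j), bs). Split i j bs" and ?mg = "\<lambda>(i, j). Merge i j"
  let ?A = "SIGMA (i, j):split_pairs \<l>. allocs \<l> i j"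
  have fin_allocs: "finite (allocs \<l> i j)" for i j
    using finite_lists_length_eq[of "{1, 2::nat}"] by (simp add: conj_commute)
  have finA: "finite ?A"
    using finite_pairs[OF \<l>] fin_allocs by (intro finite_SigmaI) auto
  have inj: "inj_on ?sp ?A" "inj_on ?mg (merge_pairs \<l>)" by (auto simp: inj_on_def)
  have "(\<Sum>\<omega>\<in>proposals S \<l>. proposal_prob S u \<l> \<omega>) =
    (\<Sum>\<omega>\<in>?sp ` ?A. proposal_prob S u \<l> \<omega>) + (\<Sum>\<omega>\<in>?mg ` merge_pairs \<l>. proposal_prob S u \<l> \<omega>)"
    unfolding proposals_eq using finA finite_pairs[OF \<l>] by (intro sum.union_disjoint) auto
  also have "(\<Sum>\<omega>\<in>?mg ` merge_pairs \<l>. proposal_prob S u \<l> \<omega>) =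
      (\<Sum>ij\<in>merge_pairs \<l>. p_merge S \<l> * w_merge S \<l> ij)"
    by (subst sum.reindex[OF inj(2)], rule sum.cong)
       (auto simp: proposal_prob_def proposals_def)
  also have "(\<Sum>\<omega>\<in>?sp ` ?A. proposal_prob S u \<l> \<omega>) =
      (\<Sum>(ij, bs)\<in>?A. p_split S \<l> * w_split S \<l> ij * alloc_prob S u (init_clusters (fst ij) (snd ij))
        (zip (visit_order S (block \<l> (fst ij)) (fst ij) (snd ij)) bs))"
    by (subst sum.reindex[OF inj(1)], rule sum.cong)
       (auto simp: proposal_prob_def proposals_def)
  also have "\<dots> = (\<Sum>ij\<in>split_pairs \<l>. \<Sum>bs\<in>(case ij of (i, j) \<Rightarrow> allocs \<l> i j).
      p_split S \<l> * w_split S \<l> ij * alloc_prob S u (init_clusters (fst ij) (snd ij))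
        (zip (visit_order S (block \<l> (fst ij)) (fst ij) (snd ij)) bs))"
    using finite_pairs[OF \<l>] fin_allocs by (subst sum.Sigma) auto
  \<comment> \<open>For each pair the label lists have total probability one, so only the move and
    pair factors survive.\<close>
  also have "\<dots> = (\<Sum>ij\<in>split_pairs \<l>. p_split S \<l> * w_split S \<l> ij)"
  proof (rule sum.cong)
    fix ij assume "ij \<in> split_pairs \<l>"
    moreover obtain i j where ij: "ij = (i, j)" by (cases ij)
    ultimately have
      "(\<Sum>bs\<in>allocs \<l> i j. alloc_prob S u (init_clusters i j) (zip (visit_order S (block \<l> i) i j) bs)) = 1"
      using init_clusters_ok[OF \<l>] by (intro sum_alloc_prob u) auto
    then show "(\<Sum>bs\<in>(case ij of (i, j) \<Rightarrow> allocs \<l> i j).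
        p_split S \<l> * w_split S \<l> ij * alloc_prob S u (init_clusters (fst ij) (snd ij))
        (zip (visit_order S (block \<l> (fst ij)) (fst ij) (snd ij)) bs)) = p_split S \<l> * w_split S \<l> ij"
      by (simp add: ij sum_distrib_left[symmetric])
  qed simp
  also have "\<dots> + (\<Sum>ij\<in>merge_pairs \<l>. p_merge S \<l> * w_merge S \<l> ij) \<le> p_split S \<l> * 1 + p_merge S \<l> * 1"
    unfolding sum_distrib_left[symmetric]
    by (intro add_mono mult_left_mono sum_w_le_1 p_nonneg)
  also have "\<dots> \<le> 1" using p_sum_le_1[of \<l>] by simp
  finally show ?thesis by simp
qed

section \<open>Acceptance, row sums and detailed balance\<close>

lemma accept_bounds:
  assumes "u \<in> space (aux_space S)" "\<l> \<in> states S" "\<l>' \<in> states S"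
  shows "0 \<le> accept S u \<l> \<l>' \<omega>" "accept S u \<l> \<l>' \<omega> \<le> 1"
proof -
  have "0 \<le> proposal_prob S u \<l> \<omega>" if "\<l> \<in> states S" for \<l> \<omega>
    using that assms(1) states_subset by (intro proposal_prob_nonneg) auto
  moreover have "0 \<le> posterior S \<l> u" if "\<l> \<in> states S" for \<l>
    using that assms(1) by (intro less_imp_le posterior_pos)
  ultimately show "0 \<le> accept S u \<l> \<l>' \<omega>" unfolding accept_def using assms by simp
qed (simp add: accept_def)

lemma off_diag_nonneg:
  assumes "u \<in> space (aux_space S)" "\<l> \<in> states S" "\<l>' \<in> states S"
  shows "0 \<le> off_diag S u \<l> \<l>'"
  unfolding off_diag_def using assms states_subset
  by (intro sum_nonneg mult_nonneg_nonneg proposal_prob_nonneg accept_bounds) auto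

text \<open>Acceptance probabilities are at most one, and proposals with different outcomes are
  different, so the row sum is bounded by the total proposal mass.\<close>

lemma sum_off_diag_le_1:
  assumes u: "u \<in> space (aux_space S)" and \<l>: "\<l> \<in> states S"
  shows "(\<Sum>\<l>'\<in>states S - {\<l>}. off_diag S u \<l> \<l>') \<le> 1"
proof -
  have part: "\<l> \<in> partitions S" using \<l> states_subset by auto
  let ?Q = "\<lambda>\<l>'. {\<omega> \<in> proposals S \<l>. propose S \<l> \<omega> = \<l>'}"
  have "(\<Sum>\<l>'\<in>states S - {\<l>}. off_diag S u \<l> \<l>') \<le>
      (\<Sum>\<l>'\<in>states S - {\<l>}. \<Sum>\<omega>\<in>?Q \<l>'. proposal_prob S u \<l> \<omega>)"
    unfolding off_diag_def
    by (intro sum_mono mult_left_le accept_bounds proposal_prob_nonneg u \<l> part) auto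
  also have "\<dots> = (\<Sum>\<omega>\<in>(\<Union>\<l>'\<in>states S - {\<l>}. ?Q \<l>'). proposal_prob S u \<l> \<omega>)"
    using finite_states finite_proposals[OF part] by (intro sum.UNION_disjoint[symmetric]) auto
  also have "\<dots> \<le> (\<Sum>\<omega>\<in>proposals S \<l>. proposal_prob S u \<l> \<omega>)"
    using finite_proposals[OF part]
    by (intro sum_mono2) (auto intro: proposal_prob_nonneg u part)
  also have "\<dots> \<le> 1" by (rule sum_proposal_prob_le_1[OF u part])
  finally show ?thesis .
qed

lemma stochastic_P_kernel:
  assumes "u \<in> space (aux_space S)"
  shows "stochastic_on (states S) (P_kernel S u)"
  unfolding stochastic_on_def
proof (intro ballI conjI)
  fix \<l> \<l>' assume "\<l> \<in> states S" "\<l>' \<in> states S"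
  then show "0 \<le> P_kernel S u \<l> \<l>'"
    unfolding P_kernel_def using assms off_diag_nonneg sum_off_diag_le_1 by simp
next
  fix \<l> assume "\<l> \<in> states S"
  then have "(\<Sum>y\<in>states S. P_kernel S u \<l> y) =
      P_kernel S u \<l> \<l> + (\<Sum>y\<in>states S - {\<l>}. P_kernel S u \<l> y)"
    using finite_states by (simp add: sum.remove)
  also have "(\<Sum>y\<in>states S - {\<l>}. P_kernel S u \<l> y) = (\<Sum>y\<in>states S - {\<l>}. off_diag S u \<l> y)"
    by (rule sum.cong) (auto simp: P_kernel_def)
  finally show "(\<Sum>y\<in>states S. P_kernel S u \<l> y) = 1" by (simp add: P_kernel_def)
qed

lemma off_diag_detailed_balance:
  assumes u: "u \<in> space (aux_space S)" and \<l>: "\<l> \<in> states S" and \<l>': "\<l>' \<in> states S"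
  shows "posterior S \<l> u * off_diag S u \<l> \<l>' = posterior S \<l>' u * off_diag S u \<l>' \<l>"
proof -
  \<comment> \<open>Each summand has the shape treated by \<open>mult_min_ratio\<close>. Moves of
    probability zero, such as a split of a finite mixture that already has \<open>L\<close> blocks,
    are included and contribute \<open>0\<close>.\<close>
  have flux: "posterior S k u * off_diag S u k k' =
      (\<Sum>\<omega> \<in> {\<omega> \<in> proposals S k. propose S k \<omega> = k'}.
        min (posterior S k u * proposal_prob S u k \<omega>)
            (posterior S k' u * proposal_prob S u k' (reverse_proposal S k \<omega>)))"
    if "k \<in> states S" "k' \<in> states S" for k k'
  proof -
    have "k \<in> partitions S" "k' \<in> partitions S" using that states_subset by auto
    moreover have "0 < posterior S k u" "0 < posterior S k' u"
      using that u by (auto intro: posterior_pos)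
    ultimately show ?thesis
      unfolding off_diag_def accept_def sum_distrib_left mult.assoc[symmetric]
      by (intro sum.cong refl mult_min_ratio mult_nonneg_nonneg proposal_prob_nonneg u) auto
  qed
  have part: "\<l> \<in> partitions S" "\<l>' \<in> partitions S" using \<l> \<l>' states_subset by auto
  show ?thesis
    unfolding flux[OF \<l> \<l>'] flux[OF \<l>' \<l>]
    \<comment> \<open>Reversal matches the two index sets and exchanges the two arguments of the
      minimum.\<close>
    by (rule sum.reindex_bij_witness[where i = "reverse_proposal S \<l>'" and j = "reverse_proposal S \<l>"])
       (auto simp: reverse_proposal[OF part(1)] reverse_proposal[OF part(2)] min.commute)
qed

lemma P_kernel_detailed_balance:
  assumes "u \<in> space (aux_space S)" "\<l> \<in> states S" "\<l>' \<in> states S"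
  shows "posterior S \<l> u * P_kernel S u \<l> \<l>' = posterior S \<l>' u * P_kernel S u \<l>' \<l>"
  using off_diag_detailed_balance[OF assms] by (cases "\<l> = \<l>'") (simp_all add: P_kernel_def)

text \<open>At fixed \<open>u\<close> all conditional probabilities share one normalizing sum, so
  detailed balance carries over from the joint posterior.\<close>

lemma reversible_P_kernel:
  assumes "u \<in> space (aux_space S)"
  shows "reversible_on (states S) (cond_posterior S u) (P_kernel S u)"
  unfolding reversible_on_def cond_posterior_def
  using P_kernel_detailed_balance[OF assms] by (simp add: divide_simps)

subsection \<open>The Markov kernel on the joint space\<close>

text \<open>The auxiliary space is a restriction of Lebesgue measure or a single point;
  measurability in \<open>u\<close> can thus be shown once over \<open>borel\<close> and transferred
  to either.\<close>

lemma borel_measurable_aux_space: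
  "f \<in> borel_measurable borel \<Longrightarrow> f \<in> borel_measurable (aux_space S)"
  unfolding aux_space_def by (cases "mixt S") (auto intro!: measurable_restrict_space1)

lemma posterior_measurable [measurable]: "(\<lambda>u. posterior S \<l> u) \<in> borel_measurable borel"
proof -
  have [measurable]: "(\<lambda>u. prior_weight n M \<l> u) \<in> borel_measurable borel" for n M
    by (cases M) (simp_all, measurable)
  show ?thesis unfolding posterior_def target_weight_def by measurable
qed

lemma alloc_prob_measurable [measurable]:
  "(\<lambda>u. alloc_prob S u R vbs) \<in> borel_measurable borel"
proof (induction vbs arbitrary: R)
  case (Cons vb vbs)
  have [measurable]: "(\<lambda>u. alloc_coeff M s u) \<in> borel_measurable borel" for M s
    by (cases M) simp_all
  have [measurable]: "(\<lambda>u. q_alloc S u R v r) \<in> borel_measurable borel" for v r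
    unfolding q_alloc_def q0_def alloc_weight_def by measurable
  obtain v b where "vb = (v, b)" by (cases vb)
  with Cons.IH show ?case by simp
qed simp

lemma proposal_prob_measurable [measurable]:
  "(\<lambda>u. proposal_prob S u \<l> \<omega>) \<in> borel_measurable borel"
  unfolding proposal_prob_def by (cases "\<omega> \<in> proposals S \<l>"; cases \<omega>) simp_all

lemma P_kernel_measurable [measurable]:
  "(\<lambda>u. P_kernel S u \<l> \<l>') \<in> borel_measurable borel"
  unfolding P_kernel_def off_diag_def accept_def by measurable

lemma space_joint_space: "space (joint_space S) = states S \<times> space (aux_space S)"
  by (simp add: joint_space_def space_pair_measure)

lemma countable_states: "countable (states S)"
  using finite_states by (rule countable_finite)

lemma slice_measurable: "u \<in> space (aux_space S) \<Longrightarrow>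
    (\<lambda>\<l>. (\<l>, u)) \<in> measurable (count_space (states S)) (joint_space S)"
  unfolding joint_space_def by (auto simp: space_pair_measure)

lemma section_measurable: "\<l> \<in> states S \<Longrightarrow>
    (\<lambda>u. (\<l>, u)) \<in> measurable (aux_space S) (joint_space S)"
  unfolding joint_space_def by simp

text \<open>The partition component is discrete and countable, so joint measurability reduces to
  measurability in \<open>u\<close> for each fixed partition.\<close>

lemma borel_measurable_joint_spaceI:
  assumes "\<And>\<l>. \<l> \<in> states S \<Longrightarrow> (\<lambda>u. f (\<l>, u)) \<in> borel_measurable (aux_space S)"
  shows "f \<in> borel_measurable (joint_space S)"
  unfolding joint_space_def
  by (rule measurable_pair_measure_countable1[OF countable_states assms])

text \<open>The kernel puts all its mass on the slice with the current \<open>u\<close>, which turns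
  its value on a set into a finite sum.\<close>

lemma emeasure_split_merge:
  assumes "\<l> \<in> states S" "u \<in> space (aux_space S)" "A \<in> sets (joint_space S)"
  shows "emeasure (split_merge S (\<l>, u)) A =
    (\<Sum>\<l>'\<in>states S. ennreal (P_kernel S u \<l> \<l>') * indicator A (\<l>', u))"
proof -
  have "emeasure (split_merge S (\<l>, u)) A =
      emeasure (density (count_space (states S)) (\<lambda>\<l>'. ennreal (P_kernel S u \<l> \<l>')))
        ((\<lambda>\<l>'. (\<l>', u)) -` A \<inter> states S)"
    unfolding split_merge_def point_measure_def prod.case using assms(3)
    by (subst emeasure_distr)
       (simp_all add: slice_measurable[OF assms(2)] del: measurable_count_space_eq1)
  also have "\<dots> = (\<Sum>\<l>'\<in>states S. ennreal (P_kernel S u \<l> \<l>') *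
      indicator ((\<lambda>\<l>'. (\<l>', u)) -` A \<inter> states S) \<l>')"
    by (simp add: emeasure_density nn_integral_count_space_finite finite_states)
  also have "\<dots> = (\<Sum>\<l>'\<in>states S. ennreal (P_kernel S u \<l> \<l>') * indicator A (\<l>', u))"
    by (intro sum.cong) (auto simp: indicator_def)
  finally show ?thesis .
qed

lemma indicator_section_measurable:
  "A \<in> sets (joint_space S) \<Longrightarrow> \<l> \<in> states S \<Longrightarrow>
    (\<lambda>u. indicator A (\<l>, u) :: ennreal) \<in> borel_measurable (aux_space S)"
  by (rule measurable_compose[OF section_measurable borel_measurable_indicator])

lemma ennreal_borel_measurable_aux_space:
  "f \<in> borel_measurable borel \<Longrightarrow> (\<lambda>u. ennreal (f u)) \<in> borel_measurable (aux_space S)"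
  by (rule measurable_compose[OF borel_measurable_aux_space measurable_ennreal])

lemma prob_space_split_merge:
  assumes "x \<in> space (joint_space S)"
  shows "prob_space (split_merge S x)"
proof -
  obtain \<l> u where x: "x = (\<l>, u)" "\<l> \<in> states S" "u \<in> space (aux_space S)"
    using assms by (auto simp: space_joint_space)
  have P: "\<forall>y\<in>states S. 0 \<le> P_kernel S u \<l> y" "(\<Sum>y\<in>states S. P_kernel S u \<l> y) = 1"
    using stochastic_P_kernel[OF x(3)] x(2) by (auto simp: stochastic_on_def)
  show "prob_space (split_merge S x)"
  proof (rule prob_spaceI)
    have "emeasure (split_merge S x) (space (joint_space S)) =
        (\<Sum>\<l>'\<in>states S. ennreal (P_kernel S u \<l> \<l>'))"
      unfolding x(1) using x
      by (subst emeasure_split_merge[OF x(2,3) sets.top]) (auto simp: space_joint_space intro!: sum.cong)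
    also have "\<dots> = 1" using P by (subst sum_ennreal) auto
    finally show "emeasure (split_merge S x) (space (split_merge S x)) = 1"
      by (simp add: split_merge_def x(1))
  qed
qed

lemma markov_kernel_split_merge: "markov_kernel (joint_space S) (split_merge S)"
  unfolding markov_kernel_def
proof (rule measurable_prob_algebraI)
  show "prob_space (split_merge S x)" if "x \<in> space (joint_space S)" for x
    using that by (rule prob_space_split_merge)
next
  show "split_merge S \<in> measurable (joint_space S) (subprob_algebra (joint_space S))"
  proof (rule measurable_subprob_algebra)
    fix A assume A: "A \<in> sets (joint_space S)"
    show "(\<lambda>x. emeasure (split_merge S x) A) \<in> borel_measurable (joint_space S)"
    proof (rule borel_measurable_joint_spaceI)
      fix \<l> assume \<l>: "\<l> \<in> states S"
      have "(\<lambda>u. \<Sum>\<l>'\<in>states S. ennreal (P_kernel S u \<l> \<l>') * indicator A (\<l>', u))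
          \<in> borel_measurable (aux_space S)"
        using A by (intro borel_measurable_sum borel_measurable_times_ennreal
          ennreal_borel_measurable_aux_space P_kernel_measurable indicator_section_measurable) auto
      then show "(\<lambda>u. emeasure (split_merge S (\<l>, u)) A) \<in> borel_measurable (aux_space S)"
        using emeasure_split_merge[OF \<l> _ A] by (simp cong: measurable_cong)
    qed
  next
    fix x assume x: "x \<in> space (joint_space S)"
    show "subprob_space (split_merge S x)"
      by (rule prob_space_imp_subprob_space[OF prob_space_split_merge[OF x]])
    show "sets (split_merge S x) = sets (joint_space S)"
      by (simp add: split_merge_def split: prod.split)
  qed
qed

section \<open>Integration against the joint target and invariance\<close>

lemma sigma_finite_aux_space: "sigma_finite_measure (aux_space S)"
  unfolding aux_space_def
  by (cases "mixt S") (auto intro!: sigma_finite_measure_restrict_space lborel.sigma_finite_measure_axioms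
      sigma_finite_measure_count_space_finite)

text \<open>Tonelli, with the partition integrated first: the inner integral against counting
  measure is a finite sum.\<close>

lemma nn_integral_joint_space:
  assumes "f \<in> borel_measurable (joint_space S)"
  shows "(\<integral>\<^sup>+x. f x \<partial>joint_space S) = (\<integral>\<^sup>+u. (\<Sum>\<l>\<in>states S. f (\<l>, u)) \<partial>aux_space S)"
proof -
  interpret pair_sigma_finite "count_space (states S)" "aux_space S"
    using finite_states
    by (intro pair_sigma_finite.intro sigma_finite_aux_space sigma_finite_measure_count_space_finite)
  show ?thesis
    using nn_integral_snd[of f] assms finite_states
    by (simp add: joint_space_def nn_integral_count_space_finite)
qed

lemma posterior_joint_measurable:
  "(\<lambda>(\<l>, u). ennreal (posterior S \<l> u)) \<in> borel_measurable (joint_space S)"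
  by (rule borel_measurable_joint_spaceI)
     (simp add: ennreal_borel_measurable_aux_space)

lemma sets_joint_target [measurable_cong]: "sets (joint_target S) = sets (joint_space S)"
  by (simp add: joint_target_def)

lemma space_joint_target: "space (joint_target S) = space (joint_space S)"
  by (simp add: joint_target_def)

lemma nn_integral_joint_target:
  assumes "f \<in> borel_measurable (joint_space S)"
  shows "(\<integral>\<^sup>+x. f x \<partial>joint_target S) =
    (\<integral>\<^sup>+u. (\<Sum>\<l>\<in>states S. ennreal (posterior S \<l> u) * f (\<l>, u)) \<partial>aux_space S)"
proof -
  have m: "(\<lambda>x. (case x of (\<l>, u) \<Rightarrow> ennreal (posterior S \<l> u)) * f x)
      \<in> borel_measurable (joint_space S)"
    using posterior_joint_measurable assms by (rule borel_measurable_times_ennreal)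
  have "(\<integral>\<^sup>+x. f x \<partial>joint_target S) =
      (\<integral>\<^sup>+x. (case x of (\<l>, u) \<Rightarrow> ennreal (posterior S \<l> u)) * f x \<partial>joint_space S)"
    unfolding joint_target_def using posterior_joint_measurable assms by (rule nn_integral_density)
  then show ?thesis by (simp add: nn_integral_joint_space[OF m])
qed

text \<open>Both measures are compared on a measurable set. As \<open>u\<close> does not move, the
  equality already holds for the integrands at each \<open>u\<close>, where it is the usual passage
  from detailed balance to stationarity.\<close>

lemma preserves_split_merge: "preserves (joint_target S) (split_merge S)"
  unfolding preserves_def
proof (cases "space (joint_space S) = {}")
  \<comment> \<open>\<open>emeasure_bind\<close> requires a nonempty space. Over an empty space the
    bind and the target are both the measure on the empty set.\<close>
  case True
  then show "joint_target S \<bind> split_merge S = joint_target S"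
    by (metis bind_empty space_empty space_joint_target)
next
  case False
  have K: "split_merge S \<in> measurable (joint_target S) (subprob_algebra (joint_space S))"
    using markov_kernel_split_merge measurable_prob_algebraD unfolding markov_kernel_def
    by (simp cong: measurable_cong_sets add: sets_joint_target)
  have ne: "space (joint_target S) \<noteq> {}" using False by (simp add: space_joint_target)
  show "joint_target S \<bind> split_merge S = joint_target S"
  proof (rule measure_eqI)
    show sets_eq: "sets (joint_target S \<bind> split_merge S) = sets (joint_target S)"
      using sets_bind[OF sets_kernel[OF K] ne] by (simp add: sets_joint_target)
    fix A assume "A \<in> sets (joint_target S \<bind> split_merge S)"
    then have A: "A \<in> sets (joint_space S)" by (simp add: sets_eq sets_joint_target)
    have "emeasure (joint_target S \<bind> split_merge S) A =
        (\<integral>\<^sup>+x. emeasure (split_merge S x) A \<partial>joint_target S)"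
      using ne K A by (rule emeasure_bind)
    also have "\<dots> = (\<integral>\<^sup>+u. (\<Sum>\<l>\<in>states S. ennreal (posterior S \<l> u) *
        emeasure (split_merge S (\<l>, u)) A) \<partial>aux_space S)"
      using measurable_emeasure_kernel[OF K A]
      by (intro nn_integral_joint_target) (simp cong: measurable_cong_sets add: sets_joint_target)
    also have "\<dots> = (\<integral>\<^sup>+u. (\<Sum>\<l>\<in>states S. ennreal (posterior S \<l> u) * indicator A (\<l>, u)) \<partial>aux_space S)"
    proof (rule nn_integral_cong)
      fix u assume u: "u \<in> space (aux_space S)"
      have P: "\<forall>y\<in>states S. 0 \<le> P_kernel S u \<l> y" "(\<Sum>y\<in>states S. P_kernel S u \<l> y) = 1"
        if "\<l> \<in> states S" for \<l>
        using stochastic_P_kernel[OF u] that by (auto simp: stochastic_on_def)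
      have "(\<Sum>\<l>\<in>states S. ennreal (posterior S \<l> u) * emeasure (split_merge S (\<l>, u)) A) =
          (\<Sum>\<l>\<in>states S. \<Sum>\<l>'\<in>states S.
            ennreal (posterior S \<l> u * P_kernel S u \<l> \<l>') * indicator A (\<l>', u))"
        using P posterior_pos[OF _ u]
        by (intro sum.cong refl)
           (simp add: emeasure_split_merge[OF _ u A] sum_distrib_left ennreal_mult'' mult.assoc)
      \<comment> \<open>After exchanging the sums, detailed balance moves the posterior weight to
        the target state \<l>', so that the inner sum runs over a row of the matrix and equals
        one.\<close>
      also have "\<dots> = (\<Sum>\<l>'\<in>states S. \<Sum>\<l>\<in>states S.
            ennreal (posterior S \<l>' u * P_kernel S u \<l>' \<l>) * indicator A (\<l>', u))"
        by (subst sum.swap) (simp add: P_kernel_detailed_balance[OF u] cong: sum.cong)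
      also have "\<dots> = (\<Sum>\<l>'\<in>states S. ennreal (posterior S \<l>' u) * indicator A (\<l>', u))"
      proof (rule sum.cong)
        fix \<l>' assume \<l>': "\<l>' \<in> states S"
        have "(\<Sum>\<l>\<in>states S. ennreal (posterior S \<l>' u * P_kernel S u \<l>' \<l>)) =
            ennreal (\<Sum>\<l>\<in>states S. posterior S \<l>' u * P_kernel S u \<l>' \<l>)"
          using P[OF \<l>'] posterior_pos[OF \<l>' u] by (intro sum_ennreal) simp
        also have "\<dots> = ennreal (posterior S \<l>' u)"
          using P[OF \<l>'] by (simp flip: sum_distrib_left)
        finally show "(\<Sum>\<l>\<in>states S. ennreal (posterior S \<l>' u * P_kernel S u \<l>' \<l>) * indicator A (\<l>', u)) =
            ennreal (posterior S \<l>' u) * indicator A (\<l>', u)"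
          by (simp flip: sum_distrib_right)
      qed simp
      finally show "(\<Sum>\<l>\<in>states S. ennreal (posterior S \<l> u) * emeasure (split_merge S (\<l>, u)) A) =
          (\<Sum>\<l>\<in>states S. ennreal (posterior S \<l> u) * indicator A (\<l>, u))" .
    qed
    also have "\<dots> = (\<integral>\<^sup>+x. indicator A x \<partial>joint_target S)"
      using A by (intro nn_integral_joint_target[symmetric]) auto
    also have "\<dots> = emeasure (joint_target S) A"
      using A by (simp add: sets_joint_target)
    finally show "emeasure (joint_target S \<bind> split_merge S) A = emeasure (joint_target S) A" .
  qed
qed

end

subsection \<open>Composition of kernels\<close>

lemma markov_kernel_compose_kernels:
  assumes "\<And>K. K \<in> set Ks \<Longrightarrow> markov_kernel M K"
  shows "markov_kernel M (compose_kernels M Ks)"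
  using assms
proof (induction Ks)
  case Nil
  show ?case unfolding markov_kernel_def
    by (auto intro!: measurable_prob_algebraI prob_space_return return_measurable)
next
  case (Cons K Ks)
  then have "K \<in> M \<rightarrow>\<^sub>M prob_algebra M" "compose_kernels M Ks \<in> M \<rightarrow>\<^sub>M prob_algebra M"
    by (auto simp: markov_kernel_def)
  then show ?case unfolding markov_kernel_def compose_kernels.simps
    by (rule measurable_bind_prob_space)
qed

text \<open>By associativity of bind the first kernel acts on \<open>T\<close> alone and leaves it
  unchanged; the induction hypothesis treats the rest. \<open>T\<close> is kept apart from
  \<open>M\<close> and shares only its measurable sets, so that the reference measure of the state
  space need not be the target.\<close>

lemma preserves_compose_kernels:
  assumes "sets T = sets M"
    and "\<And>K. K \<in> set Ks \<Longrightarrow> markov_kernel M K" "\<And>K. K \<in> set Ks \<Longrightarrow> preserves T K"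
  shows "preserves T (compose_kernels M Ks)"
  using assms(2,3)
proof (induction Ks)
  case Nil
  show ?case using assms(1) by (simp add: preserves_def bind_return'')
next
  case (Cons K Ks)
  have "K \<in> M \<rightarrow>\<^sub>M subprob_algebra M" "compose_kernels M Ks \<in> M \<rightarrow>\<^sub>M subprob_algebra M"
    using Cons.prems markov_kernel_compose_kernels[of Ks M]
    by (auto simp: markov_kernel_def intro!: measurable_prob_algebraD)
  moreover from this have "K \<in> T \<rightarrow>\<^sub>M subprob_algebra M"
    using assms(1) by (simp cong: measurable_cong_sets)
  ultimately have "T \<bind> (\<lambda>x. K x \<bind> compose_kernels M Ks) = T \<bind> K \<bind> compose_kernels M Ks"
    by (intro bind_assoc[symmetric])
  then show ?case using Cons by (simp add: preserves_def)
qed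

text \<open>The lists \<open>Ks\<close> and \<open>Ks'\<close> stand for the allocation and
  auxiliary-variable updates before and after the split-merge step, which may thus occur anywhere in
  a sweep.\<close>

theorem proposition3:
  fixes S :: "('d::finite, 'th, 'e) sm_params"
  assumes "1 \<le> num S"
    and "valid_mixture (mixt S)"
    and "\<And>x. lik S x \<in> borel_measurable (base_measure S)"
    and "\<And>x \<theta>. \<theta> \<in> space (base_measure S) \<Longrightarrow> 0 \<le> lik S x \<theta>"
    and "graph (scaffold S)" and "Digraph_Component.connected (scaffold S)"
    and "verts (scaffold S) = {1..num S}"
    and "0 < eps S" and "0 < epsD S" and "0 \<le> kappa S"
    and "proper_target S"
    and "\<And>A. A \<noteq> {} \<Longrightarrow> A \<subseteq> {1..num S} \<Longrightarrow> 0 < marg_ennreal S A \<and> marg_ennreal S A < \<infinity>"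
  shows "(\<forall>u \<in> space (aux_space S).
            stochastic_on (states S) (P_kernel S u) \<and>
            reversible_on (states S) (cond_posterior S u) (P_kernel S u)) \<and>
         markov_kernel (joint_space S) (split_merge S) \<and>
         (\<forall>Ks Ks'.
            (\<forall>K \<in> set Ks \<union> set Ks'.
               markov_kernel (joint_space S) K \<and> preserves (joint_target S) K) \<longrightarrow>
            preserves (joint_target S) (compose_kernels (joint_space S) (Ks @ split_merge S # Ks')))"
proof -
  interpret split_merge_setting S
    using assms(2,8,12) by unfold_locales auto
  have "preserves (joint_target S) (compose_kernels (joint_space S) (Ks @ split_merge S # Ks'))"
    if "\<forall>K \<in> set Ks \<union> set Ks'.
      markov_kernel (joint_space S) K \<and> preserves (joint_target S) K" for Ks Ks'
    using that markov_kernel_split_merge preserves_split_merge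
    by (intro preserves_compose_kernels sets_joint_target) auto
  then show ?thesis
    using stochastic_P_kernel reversible_P_kernel markov_kernel_split_merge by blast
qed

end
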